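(* Let $K$ be a field of characteristic not equal to $2$, and let $K^2=\{k^2:k\in K\}$. Then $K\in\mathcal{N}_{2,2}$ if and only if $K\neq K^2$, and $K\in\mathcal{N}_{2,2}^\infty$ if and only if $K\setminus K^2$ is infinite.
   Context: For $f\in K[x]$, $f^2$ denotes the second iterate $f\circ f$. $f$ has a newly reducible second iterate over $K$ if $f$ is irreducible over $K$ but $f^2$ is not irreducible over $K$. Write $K\in\mathcal{N}_{2,2}$ (resp. $K\in\mathcal{N}_{2,2}^\infty$) if there exists at least one (resp. there exist infinitely many) $f\in K[x]$ of degree $2$ with newly reducible second iterate over $K$. *)

theory Defs
  imports "HOL-Computational_Algebra.Polynomial"
begin

text \<open>
  The field \<open>K\<close> is the type \<open>'a\<close>. For \<open>f\<close> of positive degree, irreducibility in the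
  ring \<open>'a poly\<close> is irreducibility over \<open>K\<close>, since the units are the nonzero constants.
\<close>

definition newly_reducible_second_iterate :: "'a::field poly \<Rightarrow> bool" where
  "newly_reducible_second_iterate f \<longleftrightarrow> irreducible f \<and> \<not> irreducible (pcompose f f)"

definition quadratic_newly_reducible :: "'a::field poly set" where
  "quadratic_newly_reducible = {f. degree f = 2 \<and> newly_reducible_second_iterate f}"

definition in_N22 :: "'a::field itself \<Rightarrow> bool" where
  "in_N22 _ \<longleftrightarrow> (\<exists>f :: 'a poly. f \<in> quadratic_newly_reducible)"

definition in_N22_infinite :: "'a::field itself \<Rightarrow> bool" where
  "in_N22_infinite _ \<longleftrightarrow> infinite (quadratic_newly_reducible :: 'a poly set)"

definition squares :: "'a::field set" where
  "squares = {k\<^sup>2 |k. k \<in> UNIV}"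

end

theory Submission
  imports Defs
begin

text \<open>
  Write a monic quadratic polynomial as \<open>f = y\<^sup>2 + e\<close> with \<open>y = x - \<gamma>\<close>. Then
  \<open>f \<circ> f = (y\<^sup>2 + e - \<gamma>)\<^sup>2 + e\<close>, and this is even in \<open>y\<close>. The only hope for a factorisation
  when \<open>-e\<close> is not a square is one of the form \<open>(y\<^sup>2 + p y + q) (y\<^sup>2 - p y + q)\<close>. Comparing
  coefficients gives two equations that determine \<open>e\<close> and \<open>\<gamma>\<close> from \<open>p\<close> and \<open>q\<close>, with
  \<open>-4 e = p\<^sup>2 (p\<^sup>2 - 4 q)\<close>. Hence \<open>f\<close> is irreducible exactly if \<open>p \<noteq> 0\<close> and \<open>p\<^sup>2 - 4 q\<close> is not
  a square. The choice \<open>p = 2\<close>, \<open>q = 1 - d\<close> gives \<open>e = -4 d\<close> and \<open>\<gamma> = 1 - 3 d\<close>, and so a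
  polynomial \<open>split_quadratic d\<close> for each nonsquare \<open>d\<close>. Different \<open>d\<close> give different
  polynomials, so there are at least as many examples as nonsquares.

  Conversely, if every element is a square then the quadratic formula gives each quadratic
  polynomial a root, and none is irreducible. For the infinite version, suppose that there are
  infinitely many examples. Then there is a nonsquare \<open>d\<close>, and the field is infinite, since
  over a finite field there are only finitely many quadratic polynomials. All \<open>d k\<^sup>2\<close> with
  \<open>k \<noteq> 0\<close> are nonsquares, and \<open>k \<mapsto> d k\<^sup>2\<close> is at most two-to-one, so there are infinitely
  many nonsquares.
\<close>

lemma two_neq_zero_if_CHAR_neq_2:
  assumes "CHAR('a::field) \<noteq> 2"
  shows "(2 :: 'a) \<noteq> 0"
proof
  assume "(2 :: 'a) = 0"
  then have "of_nat 2 = (0 :: 'a)"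
    by simp
  then have "CHAR('a) dvd 2"
    by (simp only: of_nat_eq_0_iff_char_dvd)
  then have "CHAR('a) \<le> 2" "CHAR('a) \<noteq> 0"
    by (auto dest: dvd_imp_le intro: Nat.gr0I)
  then show False
    using assms CHAR_not_1'[where ?'a = 'a] by linarith
qed

lemma irreducible_if_degree_2_no_root:
  fixes f :: "'a::field poly"
  assumes deg: "degree f = 2" and no_root: "\<And>x. poly f x \<noteq> 0"
  shows "irreducible f"
proof (rule irreducibleI)
  show "f \<noteq> 0"
    using deg by auto
  show "\<not> f dvd 1"
    using deg \<open>f \<noteq> 0\<close> by (simp add: is_unit_iff_degree)
  fix g h
  assume f: "f = g * h"
  with \<open>f \<noteq> 0\<close> have nz: "g \<noteq> 0" "h \<noteq> 0"
    by auto
  have linear_root: "\<exists>x. poly p x = 0" if "degree p = 1" for p :: "'a poly"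
  proof -
    from that obtain a b where "p = [:b, a:]" "a \<noteq> 0"
      by (rule degree1_coeffs)
    then have "poly p (- b / a) = 0"
      by simp
    then show ?thesis ..
  qed
  have "degree g + degree h = 2"
    using f deg nz by (simp add: degree_mult_eq)
  moreover have "degree g \<noteq> 1"
    using linear_root[of g] no_root f by auto
  ultimately have "degree g = 0 \<or> degree h = 0"
    by linarith
  then show "g dvd 1 \<or> h dvd 1"
    using nz by (simp add: is_unit_iff_degree)
qed

lemma not_irreducible_if_root:
  fixes f :: "'a::field poly"
  assumes deg: "degree f > 1" and root: "poly f r = 0"
  shows "\<not> irreducible f"
proof
  assume irr: "irreducible f"
  obtain g where f: "f = [:- r, 1:] * g"
    using root by (auto simp: poly_eq_0_iff_dvd)
  then have "g \<noteq> 0"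
    using deg by auto
  then have "degree f = 1 + degree g"
    by (simp add: f degree_mult_eq del: mult_pCons_left)
  with deg have "degree g > 0"
    by simp
  moreover have "[:- r, 1:] dvd 1 \<or> g dvd 1"
    using irreducibleD[OF irr f] .
  ultimately show False
    using \<open>g \<noteq> 0\<close> by (auto simp: is_unit_iff_degree)
qed

text \<open>The quadratic formula: if the discriminant is a square, then it yields a root.\<close>

lemma nonsquare_if_irreducible_quadratic:
  fixes f :: "'a::field poly"
  assumes two: "(2 :: 'a) \<noteq> 0" and deg: "degree f = 2" and irr: "irreducible f"
  shows "(UNIV :: 'a set) \<noteq> squares"
proof
  assume all_squares: "(UNIV :: 'a set) = squares"
  obtain a b c where f: "f = [:c, b, a:]" and a: "a \<noteq> 0"
    using deg by (rule degree2_coeffs)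
  have "b\<^sup>2 - 4 * a * c \<in> squares"
    using all_squares by blast
  then obtain s where s: "b\<^sup>2 - 4 * a * c = s\<^sup>2"
    by (auto simp: squares_def)
  define r where "r = (s - b) / (2 * a)"
  have s_eq: "s = 2 * a * r + b"
    using a two by (simp add: r_def)
  have four: "(4 :: 'a) \<noteq> 0"
    using two by (metis mult_eq_0_iff numeral_Bit0 mult_2)
  have "4 * a * (c + r * (b + r * a)) = s\<^sup>2 - (b\<^sup>2 - 4 * a * c)"
    unfolding s_eq by (simp add: algebra_simps power2_eq_square)
  also have "\<dots> = 0"
    using s by simp
  finally have "c + r * (b + r * a) = 0"
    using four a by simp
  then have "poly f r = 0"
    by (simp add: f)
  then show False
    using not_irreducible_if_root[of f r] irr deg by simp
qed

text \<open>This is \<open>(x - (1 - 3 d))\<^sup>2 - 4 d\<close>.\<close>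

definition split_quadratic :: "'a::field \<Rightarrow> 'a poly" where
  "split_quadratic d = [:(1 - 3 * d)\<^sup>2 - 4 * d, - 2 * (1 - 3 * d), 1:]"

lemma poly_split_quadratic: "poly (split_quadratic d) x = (x - (1 - 3 * d))\<^sup>2 - 4 * d"
  by (simp add: split_quadratic_def algebra_simps power2_eq_square)

lemma degree_split_quadratic: "degree (split_quadratic d) = 2"
  by (simp add: split_quadratic_def)

lemma inj_split_quadratic:
  assumes two: "(2 :: 'a::field) \<noteq> 0"
  shows "inj (split_quadratic :: 'a \<Rightarrow> 'a poly)"
proof (rule injI)
  fix d e :: 'a
  assume eq: "split_quadratic d = split_quadratic e"
  (* In characteristic 3 the centre 1 - 3 d is always 1, so the constant coefficient is needed
     as well. *)
  have const: "(1 - 3 * d)\<^sup>2 - 4 * d = (1 - 3 * e)\<^sup>2 - 4 * e"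
    and lin: "- 2 * (1 - 3 * d) = - 2 * (1 - 3 * e)"
    using eq unfolding split_quadratic_def pCons_eq_iff by blast+
  from lin have centre: "1 - 3 * d = 1 - 3 * e"
    using two by (metis mult_left_cancel neg_equal_0_iff_equal)
  have "2 * (2 * d) = 2 * (2 * e)"
    using const unfolding centre by simp
  then show "d = e"
    using two by (metis mult_left_cancel)
qed

lemma irreducible_split_quadratic:
  fixes d :: "'a::field"
  assumes two: "(2 :: 'a) \<noteq> 0" and d: "d \<notin> squares"
  shows "irreducible (split_quadratic d)"
proof (rule irreducible_if_degree_2_no_root)
  fix x
  show "poly (split_quadratic d) x \<noteq> 0"
  proof
    assume "poly (split_quadratic d) x = 0"
    then have "(x - (1 - 3 * d))\<^sup>2 = 2\<^sup>2 * d"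
      by (simp add: poly_split_quadratic)
    then have "d = (x - (1 - 3 * d))\<^sup>2 / 2\<^sup>2"
      using two by (metis nonzero_mult_div_cancel_left power_not_zero)
    then have "d = ((x - (1 - 3 * d)) / 2)\<^sup>2"
      by (simp only: power_divide)
    then show False
      using d by (auto simp: squares_def)
  qed
qed (rule degree_split_quadratic)

text \<open>With \<open>y = x - (1 - 3 d)\<close>, the second iterate is
  \<open>(y\<^sup>2 - 1 - d)\<^sup>2 - 4 d = (y\<^sup>2 + 1 - d)\<^sup>2 - (2 y)\<^sup>2\<close>, a difference of squares.\<close>

lemma pcompose_split_quadratic:
  fixes d :: "'a::field"
  defines "y \<equiv> [:- (1 - 3 * d), 1:]"
  shows "pcompose (split_quadratic d) (split_quadratic d) =
    (y\<^sup>2 + [:2:] * y + [:1 - d:]) * (y\<^sup>2 - [:2:] * y + [:1 - d:])"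
  by (simp add: y_def split_quadratic_def pcompose_pCons power2_eq_square algebra_simps)

lemma not_irreducible_pcompose_split_quadratic:
  "\<not> irreducible (pcompose (split_quadratic d) (split_quadratic d))"
proof
  define y where "y = [:- (1 - 3 * d), 1:]"
  define g where "g = y\<^sup>2 + [:2:] * y + [:1 - d:]"
  define h where "h = y\<^sup>2 - [:2:] * y + [:1 - d:]"
  assume irr: "irreducible (pcompose (split_quadratic d) (split_quadratic d))"
  have "degree g = 2" "degree h = 2"
    by (simp_all add: g_def h_def y_def power2_eq_square)
  moreover from this have "g \<noteq> 0" "h \<noteq> 0"
    by auto
  ultimately have "\<not> g dvd 1" "\<not> h dvd 1"
    by (simp_all add: is_unit_iff_degree)
  moreover have "pcompose (split_quadratic d) (split_quadratic d) = g * h"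
    unfolding g_def h_def y_def by (rule pcompose_split_quadratic)
  ultimately show False
    using irreducibleD[OF irr] by blast
qed

lemma split_quadratic_newly_reducible:
  fixes d :: "'a::field"
  assumes "(2 :: 'a) \<noteq> 0" "d \<notin> squares"
  shows "split_quadratic d \<in> quadratic_newly_reducible"
  using assms
  by (simp add: quadratic_newly_reducible_def newly_reducible_second_iterate_def
      degree_split_quadratic irreducible_split_quadratic
      not_irreducible_pcompose_split_quadratic)

lemma finite_quadratic_polys:
  assumes "finite (UNIV :: 'a::zero set)"
  shows "finite {f :: 'a poly. degree f = 2}"
proof (rule finite_subset)
  show "{f :: 'a poly. degree f = 2} \<subseteq> (\<lambda>(a, b, c). [:c, b, a:]) ` (UNIV \<times> UNIV \<times> UNIV)"
  proof
    fix f :: "'a poly"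
    assume "f \<in> {f. degree f = 2}"
    then obtain a b c where "f = [:c, b, a:]"
      using degree2_coeffs[of f] by blast
    then show "f \<in> (\<lambda>(a, b, c). [:c, b, a:]) ` (UNIV \<times> UNIV \<times> UNIV)"
      by (auto intro: image_eqI[where x = "(a, b, c)"])
  qed
  show "finite ((\<lambda>(a, b, c :: 'a). [:c, b, a:]) ` (UNIV \<times> UNIV \<times> UNIV))"
    using assms by (intro finite_imageI finite_cartesian_product)
qed

text \<open>Multiplication by a fixed nonsquare \<open>d\<close> sends nonzero squares to nonsquares, so if the
  nonsquares are finite in number then so are the squares, and a finite set of squares has
  only finitely many square roots.\<close>

lemma finite_field_if_finite_nonsquares:
  fixes d :: "'a::field"
  assumes d: "d \<notin> squares" and fin: "finite ((UNIV :: 'a set) - squares)"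
  shows "finite (UNIV :: 'a set)"
proof -
  have "d \<noteq> 0"
    using d by (auto simp: squares_def intro: exI[of _ 0])
  have nonsquare: "d * k\<^sup>2 \<in> UNIV - squares" if "k \<noteq> 0" for k
  proof -
    have "d * k\<^sup>2 \<notin> squares"
    proof
      assume "d * k\<^sup>2 \<in> squares"
      then obtain l where "d * k\<^sup>2 = l\<^sup>2"
        by (auto simp: squares_def)
      then have "d = (l / k)\<^sup>2"
        using that by (simp add: power_divide nonzero_eq_divide_eq)
      then show False
        using d by (auto simp: squares_def)
    qed
    then show ?thesis
      by simp
  qed
  have fibre: "finite {k. k \<noteq> 0 \<and> d * k\<^sup>2 = n}" for n
  proof (cases "\<exists>l. d * l\<^sup>2 = n")
    case True
    then obtain l where "d * l\<^sup>2 = n" ..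
    then have "{k. k \<noteq> 0 \<and> d * k\<^sup>2 = n} \<subseteq> {l, - l}"
      using \<open>d \<noteq> 0\<close> by (auto simp: power2_eq_iff)
    then show ?thesis
      by (rule finite_subset) simp
  next
    case False
    then show ?thesis
      by simp
  qed
  have "- {0} \<subseteq> (\<Union>n \<in> UNIV - squares. {k. k \<noteq> 0 \<and> d * k\<^sup>2 = n})"
    using nonsquare by blast
  then have "finite (- {0 :: 'a})"
    by (rule finite_subset) (intro finite_UN_I fin fibre)
  then show ?thesis
    by (metis finite.emptyI finite.insertI finite_compl)
qed

theorem proposition3p2:
  assumes "CHAR('a::field) \<noteq> 2"
  shows "(in_N22 TYPE('a) \<longleftrightarrow> (UNIV :: 'a set) \<noteq> squares) \<and>
         (in_N22_infinite TYPE('a) \<longleftrightarrow> infinite ((UNIV :: 'a set) - squares))"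
proof
  have two: "(2 :: 'a) \<noteq> 0"
    using assms by (rule two_neq_zero_if_CHAR_neq_2)
  have nonsquare_if_example: "(UNIV :: 'a set) \<noteq> squares"
    if "f \<in> quadratic_newly_reducible" for f :: "'a poly"
    using that nonsquare_if_irreducible_quadratic[OF two]
    by (auto simp: quadratic_newly_reducible_def newly_reducible_second_iterate_def)
  show "in_N22 TYPE('a) \<longleftrightarrow> (UNIV :: 'a set) \<noteq> squares"
    using nonsquare_if_example split_quadratic_newly_reducible[OF two]
    by (auto simp: in_N22_def)
  show "in_N22_infinite TYPE('a) \<longleftrightarrow> infinite ((UNIV :: 'a set) - squares)"
  proof
    assume inf: "in_N22_infinite TYPE('a)"
    then obtain f :: "'a poly" where "f \<in> quadratic_newly_reducible"
      unfolding in_N22_infinite_def by (metis finite.emptyI ex_in_conv)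
    then obtain d :: 'a where d: "d \<notin> squares"
      using nonsquare_if_example by blast
    have "infinite {f :: 'a poly. degree f = 2}"
      using inf unfolding in_N22_infinite_def quadratic_newly_reducible_def
      by (rule contrapos_nn) (auto elim: rev_finite_subset)
    then show "infinite ((UNIV :: 'a set) - squares)"
      using finite_quadratic_polys finite_field_if_finite_nonsquares[OF d] by blast
  next
    assume "infinite ((UNIV :: 'a set) - squares)"
    moreover have "inj_on split_quadratic ((UNIV :: 'a set) - squares)"
      using inj_split_quadratic[OF two] by (rule inj_on_subset) simp
    ultimately have "infinite (split_quadratic ` ((UNIV :: 'a set) - squares))"
      by (simp add: finite_image_iff)
    moreover have "split_quadratic ` ((UNIV :: 'a set) - squares) \<subseteq> quadratic_newly_reducible"
      using split_quadratic_newly_reducible[OF two] by blast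
    ultimately show "in_N22_infinite TYPE('a)"
      unfolding in_N22_infinite_def using finite_subset by blast
  qed
qed

end
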